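(* Let $\phi\in\mathcal{A}$, let $f_1=h_1+\overline{g_1}\in\mathcal{W}_H^-(z)$ (that is, $h_1(z)-g_1(z)=z$) and let $f_2=h_2+\overline{g_2}\in\mathcal{W}_H^+(\phi)$ (that is, $h_2+g_2=\phi$). Then: (i) $f_1*f_2\in\mathcal{W}_H^+(h_1*\phi)$; (ii) further, if the analytic function $h_1*\phi$ is univalent in $\mathbb{D}$ and convex in the direction of the imaginary axis, and $$\operatorname{Re}\frac{(h_1*h_2)'(z)}{(h_1*\phi)'(z)}>\frac12\qquad\text{for all } z\in\mathbb{D},$$ then $f_1*f_2\in\mathcal{S}_H^0$ and $f_1*f_2$ is convex in the direction of the imaginary axis.
   Context: Let $\mathbb{D}=\{z\in\mathbb{C}:|z|<1\}$. $\mathcal{H}$ is the class of complex-valued harmonic functions $f$ in $\mathbb{D}$ with $f(0)=0=f_z(0)-1=f_{\bar z}(0)$. Each such $f$ is written $f=h+\overline{g}$ with $h(z)=z+\sum_{n\ge2}a_nz^n$ and $g(z)=\sum_{n\ge2}b_nz^n$ analytic in $\mathbb{D}$. $\mathcal{A}\subset\mathcal{H}$ is the subclass of analytic functions, i.e. analytic $\phi$ in $\mathbb{D}$ with $\phi(0)=0$, $\phi'(0)=1$. For $\phi\in\mathcal{A}$, $\mathcal{W}_H^-(\phi)=\{f=h+\overline{g}\in\mathcal{H}: h-g=\phi\}$ and $\mathcal{W}_H^+(\phi)=\{f=h+\overline{g}\in\mathcal{H}: h+g=\phi\}$; $\mathcal{W}_H^-(z)$ is the case $\phi(z)\equiv z$.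 A function $f\in\mathcal{H}$ is sense-preserving if $|g'|<|h'|$ in $\mathbb{D}$. $\mathcal{S}_H^0$ is the class of $f\in\mathcal{H}$ that are univalent (injective) and sense-preserving in $\mathbb{D}$. A domain is convex in the direction of the imaginary axis if its intersection with each vertical line is connected; $f\in\mathcal{H}$ is convex in the direction of the imaginary axis if it maps $\mathbb{D}$ onto a domain convex in that direction. Convolution: for analytic power series, $(\sum a_nz^n)*(\sum A_nz^n)=\sum a_nA_nz^n$; for $f=h+\overline g$, $F=H+\overline G$ in $\mathcal{H}$, $f*F=h*H+\overline{g*G}$. *)

theory Defs
  imports "HOL-Complex_Analysis.Complex_Analysis"
begin

abbreviation unit_disc :: "complex set" where
  "unit_disc \<equiv> ball 0 1"

text \<open>Functions on the unit disc are total functions on \<open>complex\<close> whose values outside the disc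
  are irrelevant.\<close>

definition partial_x :: "(complex \<Rightarrow> complex) \<Rightarrow> complex \<Rightarrow> complex" where
  "partial_x f z = vector_derivative (\<lambda>t. f (z + of_real t)) (at 0)"

definition partial_y :: "(complex \<Rightarrow> complex) \<Rightarrow> complex \<Rightarrow> complex" where
  "partial_y f z = vector_derivative (\<lambda>t. f (z + \<i> * of_real t)) (at 0)"

definition C1_on :: "complex set \<Rightarrow> (complex \<Rightarrow> complex) \<Rightarrow> bool" where
  "C1_on S f \<longleftrightarrow>
     (\<forall>z\<in>S. (\<lambda>t::real. f (z + of_real t)) differentiable (at 0) \<and>
            (\<lambda>t::real. f (z + \<i> * of_real t)) differentiable (at 0)) \<and>
     continuous_on S (partial_x f) \<and> continuous_on S (partial_y f)"

text \<open>Twice continuously differentiable with vanishing Laplacian; meant for open sets.\<close>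

definition harmonic_on :: "complex set \<Rightarrow> (complex \<Rightarrow> complex) \<Rightarrow> bool" where
  "harmonic_on S f \<longleftrightarrow>
     C1_on S f \<and> C1_on S (partial_x f) \<and> C1_on S (partial_y f) \<and>
     (\<forall>z\<in>S. partial_x (partial_x f) z + partial_y (partial_y f) z = 0)"

definition wirtinger :: "(complex \<Rightarrow> complex) \<Rightarrow> complex \<Rightarrow> complex" where
  "wirtinger f z = (partial_x f z - \<i> * partial_y f z) / 2"

definition wirtinger_cnj :: "(complex \<Rightarrow> complex) \<Rightarrow> complex \<Rightarrow> complex" where
  "wirtinger_cnj f z = (partial_x f z + \<i> * partial_y f z) / 2"

definition class_H :: "(complex \<Rightarrow> complex) set" where
  "class_H = {f. harmonic_on unit_disc f \<and> f 0 = 0 \<and> wirtinger f 0 = 1 \<and> wirtinger_cnj f 0 = 0}"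

definition class_A :: "(complex \<Rightarrow> complex) set" where
  "class_A = {\<phi>. \<phi> holomorphic_on unit_disc \<and> \<phi> 0 = 0 \<and> deriv \<phi> 0 = 1}"

text \<open>\<open>f = h + cnj g\<close> on the disc, where \<open>h(z) = z + \<Sum>n\<ge>2. a\<^sub>n z\<^sup>n\<close> and
  \<open>g(z) = \<Sum>n\<ge>2. b\<^sub>n z\<^sup>n\<close>. On the disc, \<open>f\<close> determines \<open>h\<close> and \<open>g\<close>.\<close>

definition canonical_decomp ::
    "(complex \<Rightarrow> complex) \<Rightarrow> (complex \<Rightarrow> complex) \<Rightarrow> (complex \<Rightarrow> complex) \<Rightarrow> bool" where
  "canonical_decomp f h g \<longleftrightarrow>
     h holomorphic_on unit_disc \<and> g holomorphic_on unit_disc \<and>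
     h 0 = 0 \<and> deriv h 0 = 1 \<and> g 0 = 0 \<and> deriv g 0 = 0 \<and>
     (\<forall>z\<in>unit_disc. f z = h z + cnj (g z))"

definition W_minus :: "(complex \<Rightarrow> complex) \<Rightarrow> (complex \<Rightarrow> complex) set" where
  "W_minus \<phi> = {f \<in> class_H. \<exists>h g. canonical_decomp f h g \<and> (\<forall>z\<in>unit_disc. h z - g z = \<phi> z)}"

definition W_plus :: "(complex \<Rightarrow> complex) \<Rightarrow> (complex \<Rightarrow> complex) set" where
  "W_plus \<phi> = {f \<in> class_H. \<exists>h g. canonical_decomp f h g \<and> (\<forall>z\<in>unit_disc. h z + g z = \<phi> z)}"

definition sense_preserving :: "(complex \<Rightarrow> complex) \<Rightarrow> bool" where
  "sense_preserving f \<longleftrightarrow>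
     (\<exists>h g. canonical_decomp f h g \<and> (\<forall>z\<in>unit_disc. cmod (deriv g z) < cmod (deriv h z)))"

definition class_SH0 :: "(complex \<Rightarrow> complex) set" where
  "class_SH0 = {f \<in> class_H. inj_on f unit_disc \<and> sense_preserving f}"

definition convex_imag_dir :: "complex set \<Rightarrow> bool" where
  "convex_imag_dir S \<longleftrightarrow> (\<forall>c::real. connected (S \<inter> {w. Re w = c}))"

text \<open>The image has to be a domain, i.e. open and connected (nonemptiness is automatic).\<close>

definition fun_convex_imag_dir :: "(complex \<Rightarrow> complex) \<Rightarrow> bool" where
  "fun_convex_imag_dir f \<longleftrightarrow>
     open (f ` unit_disc) \<and> connected (f ` unit_disc) \<and> convex_imag_dir (f ` unit_disc)"

text \<open>Convolution of functions analytic in the disc: coefficientwise product of the Taylor series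
  at \<open>0\<close>.\<close>

definition analytic_conv ::
    "(complex \<Rightarrow> complex) \<Rightarrow> (complex \<Rightarrow> complex) \<Rightarrow> complex \<Rightarrow> complex" where
  "analytic_conv h H =
     eval_fps (Abs_fps (\<lambda>n. fps_nth (fps_expansion h 0) n * fps_nth (fps_expansion H 0) n))"

text \<open>The choices below are unique on the disc, and the convolution only depends on germs at \<open>0\<close>.\<close>

definition analytic_part :: "(complex \<Rightarrow> complex) \<Rightarrow> complex \<Rightarrow> complex" where
  "analytic_part f = (SOME h. \<exists>g. canonical_decomp f h g)"

definition coanalytic_part :: "(complex \<Rightarrow> complex) \<Rightarrow> complex \<Rightarrow> complex" where
  "coanalytic_part f = (SOME g. \<exists>h. canonical_decomp f h g)"

definition harmonic_conv ::
    "(complex \<Rightarrow> complex) \<Rightarrow> (complex \<Rightarrow> complex) \<Rightarrow> complex \<Rightarrow> complex" where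
  "harmonic_conv f F z =
     analytic_conv (analytic_part f) (analytic_part F) z +
     cnj (analytic_conv (coanalytic_part f) (coanalytic_part F) z)"

end

theory Submission
  imports Defs
begin

text \<open>
  Write \<open>H = h1 * h2\<close>, \<open>G = g1 * g2\<close> and \<open>\<Phi> = h1 * \<phi>\<close>, where \<open>*\<close> is the coefficientwise
  product. Since \<open>h1 - g1 = z\<close>, the Taylor coefficients of \<open>h1\<close> and \<open>g1\<close> agree except at
  index 1, where the coefficient of \<open>g2\<close> vanishes. Hence \<open>g1 * g2 = h1 * g2\<close> and
  \<open>H + G = h1 * (h2 + g2) = \<Phi>\<close>, which is the first claim.

  For the second claim put \<open>f = H + cnj G\<close>. Then \<open>f = \<Phi> - 2 \<i> Im G\<close>, so \<open>f\<close> is obtained from the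
  univalent map \<open>\<Phi>\<close> by moving each image point along its vertical line: on \<open>\<Phi>(\<D>)\<close> the map
  \<open>F = f \<circ> \<Phi>\<inverse>\<close> satisfies \<open>Re (F w) = Re w\<close>. Its derivative along a vertical line is
  \<open>1 - 2 Re (G' / \<Phi>') = 2 Re (H' / \<Phi>') - 1 > 0\<close>, by the hypothesis on the real part. As each
  vertical line meets \<open>\<Phi>(\<D>)\<close> in an interval, \<open>F\<close> is strictly increasing there. So \<open>F\<close> is
  injective and maps each vertical slice of \<open>\<Phi>(\<D>)\<close> onto the corresponding slice of \<open>f(\<D>)\<close>,
  which is therefore connected. This is the shear construction of Clunie and Sheil-Small; the two
  steps are \<open>vertical_shear\<close> and \<open>harmonic_shear\<close> below. The same
  real part condition says that \<open>H' / \<Phi>'\<close> is closer to \<open>1\<close> than to \<open>0\<close>, that is,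
  \<open>\<bar>G'\<bar> < \<bar>H'\<bar>\<close>.

  The analytic parts in the definition of the convolution are arbitrary choices. That
  they may be replaced by the given \<open>h1, g1, h2, g2\<close> follows because the Wirtinger derivatives of
  \<open>h + cnj g\<close> are \<open>h'\<close> and \<open>cnj g'\<close>, so that \<open>f\<close> determines \<open>h\<close> and \<open>g\<close> on the disc.
\<close>

section \<open>Harmonic functions of the form \<open>h + cnj g\<close>\<close>

lemma has_vector_derivative_add_cnj:
  assumes S: "open S" and h: "h holomorphic_on S" and g: "g holomorphic_on S"
    and f: "\<And>z. z \<in> S \<Longrightarrow> f z = h z + cnj (g z)" and z: "z \<in> S"
  shows "((\<lambda>t::real. f (z + c * of_real t)) has_vector_derivative
           c * deriv h z + cnj (c * deriv g z)) (at 0)"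
proof -
  have line: "((\<lambda>t::real. z + c * of_real t) has_vector_derivative c) (at 0)"
    by (auto intro!: derivative_eq_intros simp: has_vector_derivative_def scaleR_conv_of_real)
  have "((\<lambda>t::real. u (z + c * of_real t)) has_vector_derivative c * deriv u z) (at 0)"
    if "u holomorphic_on S" for u
    using field_vector_diff_chain_at[OF line, of u "deriv u z"]
      holomorphic_derivI[OF that S z] by (simp add: o_def)
  note this[OF h] and this[OF g]
  then have deriv: "((\<lambda>t::real. h (z + c * of_real t) + cnj (g (z + c * of_real t)))
      has_vector_derivative c * deriv h z + cnj (c * deriv g z)) (at 0)"
    by (intro has_vector_derivative_add has_vector_derivative_cnj)
  have "((\<lambda>t::real. z + c * of_real t) \<longlongrightarrow> z + c * of_real 0) (at 0)"
    by (intro tendsto_intros)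
  then have "eventually (\<lambda>t::real. z + c * of_real t \<in> S) (at 0)"
    using S z by (intro topological_tendstoD) auto
  then have "eventually (\<lambda>t::real. z + c * of_real t \<in> S) (nhds 0)"
    using z by (simp add: eventually_nhds_conv_at)
  then have eq: "eventually (\<lambda>t::real. h (z + c * of_real t) + cnj (g (z + c * of_real t))
      = f (z + c * of_real t)) (nhds 0)"
    by eventually_elim (simp add: f)
  show ?thesis
    by (rule iffD1[OF has_vector_derivative_cong_ev deriv])
       (use eq in \<open>auto simp: f z elim: eventually_mono\<close>)
qed

lemma C1_on_add_cnj:
  assumes S: "open S" and h: "h holomorphic_on S" and g: "g holomorphic_on S"
    and f: "\<And>z. z \<in> S \<Longrightarrow> f z = h z + cnj (g z)"
  shows partial_x_add_cnj: "\<And>z. z \<in> S \<Longrightarrow> partial_x f z = deriv h z + cnj (deriv g z)"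
    and partial_y_add_cnj: "\<And>z. z \<in> S \<Longrightarrow> partial_y f z = \<i> * deriv h z + cnj (\<i> * deriv g z)"
    and "C1_on S f"
proof -
  note deriv = has_vector_derivative_add_cnj[OF S h g f]
  show px: "partial_x f z = deriv h z + cnj (deriv g z)" if "z \<in> S" for z
    using deriv[OF _ that, where c = 1] vector_derivative_at by (fastforce simp: partial_x_def)
  show py: "partial_y f z = \<i> * deriv h z + cnj (\<i> * deriv g z)" if "z \<in> S" for z
    using deriv[OF _ that, where c = \<i>] vector_derivative_at by (fastforce simp: partial_y_def)
  have cont: "continuous_on S (deriv h)" "continuous_on S (deriv g)"
    using S h g by (auto intro!: holomorphic_on_imp_continuous_on holomorphic_deriv)
  have "continuous_on S (partial_x f)" "continuous_on S (partial_y f)"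
    by (subst continuous_on_cong[OF refl px] continuous_on_cong[OF refl py], assumption,
        intro continuous_intros cont)+
  then show "C1_on S f"
    using deriv[where c = 1] deriv[where c = \<i>]
    by (auto simp: C1_on_def intro: differentiableI_vector)
qed

lemma wirtinger_add_cnj:
  assumes "open S" "h holomorphic_on S" "g holomorphic_on S"
    and "\<And>z. z \<in> S \<Longrightarrow> f z = h z + cnj (g z)" and "z \<in> S"
  shows "wirtinger f z = deriv h z" "wirtinger_cnj f z = cnj (deriv g z)"
  using partial_x_add_cnj[OF assms] partial_y_add_cnj[OF assms]
  by (auto simp: wirtinger_def wirtinger_cnj_def complex_eq_iff)

text \<open>The partial derivatives of \<open>h + cnj g\<close> are again of this form, with \<open>(h, g)\<close> replaced by
  \<open>(h', g')\<close> and \<open>(\<i> h', \<i> g')\<close>, so second derivatives need no separate computation.\<close>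

lemma harmonic_on_add_cnj:
  assumes S: "open S" and h: "h holomorphic_on S" and g: "g holomorphic_on S"
    and f: "\<And>z. z \<in> S \<Longrightarrow> f z = h z + cnj (g z)"
  shows "harmonic_on S f"
proof -
  have h': "deriv h holomorphic_on S" and g': "deriv g holomorphic_on S"
    using S h g by (auto intro: holomorphic_deriv)
  have ih': "(\<lambda>z. \<i> * deriv h z) holomorphic_on S" and ig': "(\<lambda>z. \<i> * deriv g z) holomorphic_on S"
    by (intro holomorphic_intros h' g')+
  note px = partial_x_add_cnj[OF S h g f]
  note py = partial_y_add_cnj[OF S h g f]
  have "deriv (\<lambda>z. \<i> * u z) z = \<i> * deriv u z" if "u holomorphic_on S" "z \<in> S" for u z
    using that S by (simp add: holomorphic_on_imp_differentiable_at)
  note this[OF h'] and this[OF g']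
  then have "\<forall>z\<in>S. partial_x (partial_x f) z + partial_y (partial_y f) z = 0"
    by (simp add: partial_x_add_cnj[OF S h' g' px] partial_y_add_cnj[OF S ih' ig' py])
  then show ?thesis
    using C1_on_add_cnj(3)[OF S h g f] C1_on_add_cnj(3)[OF S h' g' px]
      C1_on_add_cnj(3)[OF S ih' ig' py]
    by (auto simp: harmonic_on_def)
qed

lemma canonical_decomp_imp_class_H:
  assumes "canonical_decomp f h g"
  shows "f \<in> class_H"
  using assms harmonic_on_add_cnj[of unit_disc h g f] wirtinger_add_cnj[of unit_disc h g f 0]
  by (simp add: canonical_decomp_def class_H_def)

text \<open>The Wirtinger derivatives recover \<open>h'\<close> and \<open>g'\<close> from \<open>f\<close>, and \<open>h 0 = g 0 = 0\<close> fixes the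
  constants of integration.\<close>

lemma canonical_decomp_unique:
  assumes d: "canonical_decomp f h g" and d': "canonical_decomp f h' g'" and z: "z \<in> unit_disc"
  shows "h z = h' z" "g z = g' z"
proof -
  have eq: "u z = v z"
    if uv: "u holomorphic_on unit_disc" "v holomorphic_on unit_disc" "u 0 = v 0"
      and deriv: "\<And>w. w \<in> unit_disc \<Longrightarrow> deriv u w = deriv v w" for u v :: "complex \<Rightarrow> complex"
  proof -
    have "((\<lambda>w. u w - v w) has_field_derivative 0) (at w within unit_disc)" if "w \<in> unit_disc" for w
    proof (rule has_field_derivative_at_within)
      show "((\<lambda>w. u w - v w) has_field_derivative 0) (at w)"
        using holomorphic_derivI[OF uv(1) open_ball that] holomorphic_derivI[OF uv(2) open_ball that]
          deriv[OF that] by (auto intro!: derivative_eq_intros)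
    qed
    then obtain c where "\<forall>w\<in>unit_disc. u w - v w = c"
      using has_field_derivative_zero_constant[OF convex_ball] by blast
    moreover have "0 \<in> unit_disc"
      by simp
    ultimately show ?thesis
      using z uv(3) by (metis eq_iff_diff_eq_0)
  qed
  have W: "wirtinger f w = deriv h w" "wirtinger_cnj f w = cnj (deriv g w)"
          "wirtinger f w = deriv h' w" "wirtinger_cnj f w = cnj (deriv g' w)"
    if "w \<in> unit_disc" for w
    using d d' that wirtinger_add_cnj[of unit_disc _ _ f w] by (auto simp: canonical_decomp_def)
  have hol: "h holomorphic_on unit_disc" "h' holomorphic_on unit_disc" "h 0 = h' 0"
            "g holomorphic_on unit_disc" "g' holomorphic_on unit_disc" "g 0 = g' 0"
    using d d' by (auto simp: canonical_decomp_def)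
  show "h z = h' z"
    by (rule eq[OF hol(1-3)]) (metis W(1,3))
  show "g z = g' z"
    by (rule eq[OF hol(4-6)]) (metis W(2,4) complex_cnj_cnj)
qed

section \<open>Coefficientwise products\<close>

text \<open>For \<open>t < r s\<close> split \<open>t = u v\<close> with \<open>u < r\<close> and \<open>v < s\<close>; then \<open>a\<^sub>n u\<^sup>n\<close> is absolutely summable
  and \<open>b\<^sub>n v\<^sup>n\<close> is bounded.\<close>

lemma conv_radius_coeff_product_ge:
  fixes a b :: "nat \<Rightarrow> complex"
  assumes r: "0 < r" "ereal r \<le> conv_radius a" and s: "0 < s" "ereal s \<le> conv_radius b"
  shows "ereal (r * s) \<le> conv_radius (\<lambda>n. a n * b n)"
proof (rule conv_radius_geI_ex')
  fix t :: real
  assume t: "0 < t" "ereal t < ereal (r * s)"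
  define q where "q = sqrt (t / (r * s))"
  have q: "0 < q" "q < 1" "q * q = t / (r * s)"
    using t r s by (auto simp: q_def)
  then have uv: "0 < r * q" "r * q < r" "0 < s * q" "s * q < s"
    using r s by auto
  have t_eq: "t = (r * q) * (s * q)"
    using q(3) r s by (simp add: field_simps)
  have norm_uv: "norm (complex_of_real (r * q)) = r * q" "norm (complex_of_real (s * q)) = s * q"
    using uv by (simp_all only: norm_of_real abs_of_pos)
  have "ereal (r * q) < conv_radius a" "ereal (s * q) < conv_radius b"
    using uv r s by (auto intro: less_le_trans[rotated])
  then have sum_a: "summable (\<lambda>n. norm (a n * of_real (r * q) ^ n))"
    and sum_b: "summable (\<lambda>n. norm (b n * of_real (s * q) ^ n))"
    by (intro abs_summable_in_conv_radius; simp only: norm_uv)+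
  then have "Bseq (\<lambda>n. b n * of_real (s * q) ^ n)"
    by (blast intro: convergent_imp_Bseq convergentI summable_LIMSEQ_zero summable_norm_cancel)
  then obtain K where K: "\<And>n. norm (b n * of_real (s * q) ^ n) \<le> K"
    by (meson BseqE)
  have "summable (\<lambda>n. K * norm (a n * of_real (r * q) ^ n))"
    by (intro summable_mult sum_a)
  moreover have "norm (a n * b n * of_real t ^ n) \<le> K * norm (a n * of_real (r * q) ^ n)" for n
  proof -
    have "a n * b n * of_real t ^ n
        = (b n * of_real (s * q) ^ n) * (a n * of_real (r * q) ^ n)"
      by (simp add: t_eq power_mult_distrib)
    then show ?thesis
      using mult_right_mono[OF K, of "norm (a n * of_real (r * q) ^ n)" n]
      by (simp only: norm_mult[of "b n * _"] norm_ge_zero)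
  qed
  ultimately show "summable (\<lambda>n. a n * b n * of_real t ^ n)"
    by (rule summable_comparison_test'[where N = 0])
qed

definition conv_fps :: "(complex \<Rightarrow> complex) \<Rightarrow> (complex \<Rightarrow> complex) \<Rightarrow> complex fps" where
  "conv_fps h H = Abs_fps (\<lambda>n. fps_nth (fps_expansion h 0) n * fps_nth (fps_expansion H 0) n)"

lemma conv_radius_fps_expansion_disc:
  assumes "h holomorphic_on unit_disc"
  shows "1 \<le> fps_conv_radius (fps_expansion h 0)"
  using conv_radius_fps_expansion[of h 0 1] assms by (simp add: one_ereal_def)

lemma conv_fps_radius:
  assumes "h holomorphic_on unit_disc" "H holomorphic_on unit_disc"
  shows "1 \<le> fps_conv_radius (conv_fps h H)"
  using conv_radius_coeff_product_ge[of 1 _ 1] assms[THEN conv_radius_fps_expansion_disc]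
  by (simp add: fps_conv_radius_def conv_fps_def one_ereal_def)

lemma analytic_conv_eq: "analytic_conv h H = eval_fps (conv_fps h H)"
  by (simp add: analytic_conv_def conv_fps_def)

lemma analytic_conv_holomorphic:
  assumes "h holomorphic_on unit_disc" "H holomorphic_on unit_disc"
  shows "analytic_conv h H holomorphic_on unit_disc"
  unfolding analytic_conv_eq
  using conv_fps_radius[OF assms]
  by (intro holomorphic_on_eval_fps ball_eball_mono) (simp add: one_ereal_def)

lemma fps_expansion_0_nth:
  "fps_nth (fps_expansion h 0) 0 = h 0"
  "fps_nth (fps_expansion h 0) (Suc 0) = deriv h 0"
  by (simp_all add: fps_expansion_def)

lemma analytic_conv_0: "analytic_conv h H 0 = h 0 * H 0"
  by (simp add: analytic_conv_eq eval_fps_at_0 conv_fps_def fps_expansion_0_nth)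

lemma deriv_analytic_conv_0:
  assumes "h holomorphic_on unit_disc" "H holomorphic_on unit_disc"
  shows "deriv (analytic_conv h H) 0 = deriv h 0 * deriv H 0"
proof -
  have "0 < fps_conv_radius (conv_fps h H)"
    using conv_fps_radius[OF assms] by (rule less_le_trans[rotated]) simp
  then show ?thesis
    using eval_fps_deriv[of 0 "conv_fps h H"]
    by (simp add: analytic_conv_eq eval_fps_at_0 conv_fps_def fps_expansion_0_nth zero_ereal_def)
qed

lemma fps_expansion_disc_cong:
  assumes "\<And>z. z \<in> unit_disc \<Longrightarrow> h z = h' z"
  shows "fps_expansion h 0 = fps_expansion h' 0"
  by (rule fps_expansion_cong, rule eventually_mono[OF eventually_nhds_in_open[of unit_disc]])
     (auto simp: assms)

lemma analytic_conv_cong: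
  assumes "\<And>z. z \<in> unit_disc \<Longrightarrow> h z = h' z" "\<And>z. z \<in> unit_disc \<Longrightarrow> H z = H' z"
  shows "analytic_conv h H = analytic_conv h' H'"
  using fps_expansion_disc_cong[OF assms(1)] fps_expansion_disc_cong[OF assms(2)]
  by (simp add: analytic_conv_def)

text \<open>The chosen parts agree with \<open>h, g, H, G\<close> on the disc by uniqueness, and the coefficientwise
  product sees only the values on the disc.\<close>

lemma harmonic_conv_eq:
  assumes "canonical_decomp f h g" "canonical_decomp F H G"
  shows "harmonic_conv f F z = analytic_conv h H z + cnj (analytic_conv g G z)"
proof -
  have parts: "(\<forall>z\<in>unit_disc. analytic_part f z = h z) \<and> (\<forall>z\<in>unit_disc. coanalytic_part f z = g z)"
    if d: "canonical_decomp f h g" for f h g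
  proof -
    have "\<exists>g. canonical_decomp f (analytic_part f) g"
      unfolding analytic_part_def by (rule someI[of _ h]) (use d in blast)
    moreover have "\<exists>h. canonical_decomp f h (coanalytic_part f)"
      unfolding coanalytic_part_def by (rule someI[of _ g]) (use d in blast)
    ultimately show ?thesis
      using canonical_decomp_unique[OF _ d] by blast
  qed
  show ?thesis
    using analytic_conv_cong[of "analytic_part f" h "analytic_part F" H]
      analytic_conv_cong[of "coanalytic_part f" g "coanalytic_part F" G]
      parts[OF assms(1)] parts[OF assms(2)]
    by (simp add: harmonic_conv_def)
qed

lemma canonical_decomp_harmonic_conv:
  assumes "canonical_decomp f h g" "canonical_decomp F H G"
  shows "canonical_decomp (harmonic_conv f F) (analytic_conv h H) (analytic_conv g G)"
  using assms harmonic_conv_eq[OF assms]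
  by (simp add: canonical_decomp_def analytic_conv_holomorphic analytic_conv_0
      deriv_analytic_conv_0)

lemma fps_expansion_add:
  assumes "h holomorphic_on unit_disc" "g holomorphic_on unit_disc"
  shows "fps_nth (fps_expansion (\<lambda>z. h z + g z) 0) n
    = fps_nth (fps_expansion h 0) n + fps_nth (fps_expansion g 0) n"
  using higher_deriv_add[OF assms open_ball, of 0 n]
  by (simp add: fps_expansion_def add_divide_distrib)

text \<open>Adding \<open>z\<close> to \<open>g1\<close> changes only the coefficient at index 1, which is multiplied by the
  vanishing derivative of \<open>g2\<close> at \<open>0\<close>. So \<open>g1 * g2 = h1 * g2\<close>, and the coefficientwise product
  with \<open>h1\<close> is additive.\<close>

lemma analytic_conv_add_eq:
  assumes hol: "h1 holomorphic_on unit_disc" "g1 holomorphic_on unit_disc"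
      "h2 holomorphic_on unit_disc" "g2 holomorphic_on unit_disc"
    and diff: "\<And>z. z \<in> unit_disc \<Longrightarrow> h1 z - g1 z = z"
    and sum: "\<And>z. z \<in> unit_disc \<Longrightarrow> h2 z + g2 z = \<phi> z"
    and g2: "deriv g2 0 = 0"
    and z: "z \<in> unit_disc"
  shows "analytic_conv h1 h2 z + analytic_conv g1 g2 z = analytic_conv h1 \<phi> z"
proof -
  have "fps_expansion h1 0 = fps_expansion (\<lambda>z. z + g1 z) 0"
    by (rule fps_expansion_disc_cong) (metis diff diff_add_cancel)
  then have a: "fps_nth (fps_expansion h1 0) n
      = fps_nth (fps_expansion (\<lambda>z. z) 0) n + fps_nth (fps_expansion g1 0) n" for n
    using fps_expansion_add[of "\<lambda>z. z" g1 n] hol by (simp add: holomorphic_on_ident)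
  have id: "fps_nth (fps_expansion (\<lambda>z::complex. z) 0) n = (if n = 1 then 1 else 0)" for n
    by (auto simp: fps_expansion_def higher_deriv_ident)
  have "fps_expansion \<phi> 0 = fps_expansion (\<lambda>z. h2 z + g2 z) 0"
    by (rule fps_expansion_disc_cong) (simp add: sum)
  then have b: "fps_nth (fps_expansion \<phi> 0) n
      = fps_nth (fps_expansion h2 0) n + fps_nth (fps_expansion g2 0) n" for n
    using fps_expansion_add[OF hol(3,4)] by simp
  have "conv_fps h1 \<phi> = conv_fps h1 h2 + conv_fps g1 g2"
    by (rule fps_ext)
       (auto simp: conv_fps_def b a id fps_expansion_0_nth g2 algebra_simps)
  have "ereal (norm z) < 1"
    using z by simp
  then have "ereal (norm z) < fps_conv_radius (conv_fps h1 h2)"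
    and "ereal (norm z) < fps_conv_radius (conv_fps g1 g2)"
    using conv_fps_radius hol less_le_trans by blast+
  note eval_fps_add[OF this]
  then show ?thesis
    by (simp only: analytic_conv_eq \<open>conv_fps h1 \<phi> = _\<close>)
qed

section \<open>The shear construction\<close>

text \<open>A map that moves points only along vertical lines, and does so with positive speed, is
  strictly increasing on each vertical slice of \<open>S\<close> because these slices are intervals.\<close>

lemma vertical_shear:
  fixes F :: "complex \<Rightarrow> complex"
  assumes S: "convex_imag_dir S" and cont: "continuous_on S F"
    and Re: "\<And>w. w \<in> S \<Longrightarrow> Re (F w) = Re w"
    and deriv: "\<And>w. w \<in> S \<Longrightarrow>
      \<exists>d>0. ((\<lambda>t::real. Im (F (w + \<i> * of_real t))) has_real_derivative d) (at 0)"
  shows "inj_on F S" and "convex_imag_dir (F ` S)"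
proof -
  have less: "Im (F v) < Im (F w)" if vw: "v \<in> S" "w \<in> S" "Re v = Re w" "Im v < Im w" for v w
  proof -
    have "connected (Im ` (S \<inter> {u. Re u = Re w}))"
      using S by (intro connected_continuous_image continuous_intros) (auto simp: convex_imag_dir_def)
    moreover have "Im v \<in> Im ` (S \<inter> {u. Re u = Re w})" "Im w \<in> Im ` (S \<inter> {u. Re u = Re w})"
      using vw by auto
    ultimately have sub: "{Im v..Im w} \<subseteq> Im ` (S \<inter> {u. Re u = Re w})"
      by (rule connected_contains_Icc)
    have mem: "Complex (Re w) t \<in> S" if "t \<in> {Im v..Im w}" for t
    proof -
      have "t \<in> Im ` (S \<inter> {u. Re u = Re w})"
        using that sub by blast
      then obtain u where "u \<in> S" "Re u = Re w" "t = Im u"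
        by blast
      then show ?thesis
        by (metis complex_surj)
    qed
    have "Im (F (Complex (Re w) (Im v))) < Im (F (Complex (Re w) (Im w)))"
    proof (rule DERIV_pos_imp_increasing[OF vw(4)])
      fix t assume "Im v \<le> t" "t \<le> Im w"
      then obtain d where d: "d > 0"
        "((\<lambda>x::real. Im (F (Complex (Re w) t + \<i> * of_real x))) has_real_derivative d) (at 0)"
        using deriv[OF mem[of t]] by auto
      have "Complex (Re w) t + \<i> * of_real x = Complex (Re w) (x + t)" for x
        by (simp add: complex_eq_iff)
      with d show "\<exists>d. ((\<lambda>t. Im (F (Complex (Re w) t))) has_real_derivative d) (at t) \<and> 0 < d"
        using DERIV_shift[of "\<lambda>t. Im (F (Complex (Re w) t))" d 0 t] by auto
    qed
    then show ?thesis
      using vw(3) by (metis complex_surj)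
  qed
  show "inj_on F S"
  proof (rule inj_onI)
    fix v w assume "v \<in> S" "w \<in> S" "F v = F w"
    then show "v = w"
      using less[of v w] less[of w v] Re[of v] Re[of w]
      by (metis complex_eqI less_irrefl linorder_neqE_linordered_idom)
  qed
  have "F ` S \<inter> {w. Re w = c} = F ` (S \<inter> {w. Re w = c})" for c
    using Re by auto
  moreover have "connected (F ` (S \<inter> {w. Re w = c}))" for c
    using S cont
    by (intro connected_continuous_image) (auto simp: convex_imag_dir_def intro: continuous_on_subset)
  ultimately show "convex_imag_dir (F ` S)"
    by (simp add: convex_imag_dir_def)
qed

text \<open>With \<open>\<Phi> = h + g\<close> one has \<open>h + cnj g = \<Phi> - 2 \<i> Im g\<close>. Read in the coordinate \<open>w = \<Phi> z\<close> this is
  a vertical shear of \<open>\<Phi> ` U\<close> whose speed is \<open>1 - 2 Re (g' / \<Phi>') = 2 Re (h' / \<Phi>') - 1\<close>.\<close>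

lemma harmonic_shear:
  assumes U: "open U" "connected U"
    and h: "h holomorphic_on U" and g: "g holomorphic_on U"
    and inj: "inj_on (\<lambda>z. h z + g z) U" and cid: "convex_imag_dir ((\<lambda>z. h z + g z) ` U)"
    and Re: "\<And>z. z \<in> U \<Longrightarrow> Re (deriv h z / (deriv h z + deriv g z)) > 1 / 2"
  defines "f \<equiv> \<lambda>z. h z + cnj (g z)"
  shows "inj_on f U" "open (f ` U)" "connected (f ` U)" "convex_imag_dir (f ` U)"
proof -
  define \<Phi> where "\<Phi> = (\<lambda>z. h z + g z)"
  have hol: "\<Phi> holomorphic_on U"
    unfolding \<Phi>_def by (intro holomorphic_intros h g)
  obtain \<Psi> where \<Psi>: "\<Psi> holomorphic_on \<Phi> ` U"
    and \<Psi>': "\<And>z. z \<in> U \<Longrightarrow> deriv \<Phi> z * deriv \<Psi> (\<Phi> z) = 1"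
    and inv: "\<And>z. z \<in> U \<Longrightarrow> \<Psi> (\<Phi> z) = z"
    using holomorphic_has_inverse[OF hol U(1)] inj unfolding \<Phi>_def by metis
  have open_im: "open (\<Phi> ` U)"
    using open_mapping_thm3[OF hol U(1)] inj by (simp add: \<Phi>_def)
  define F where "F = f \<circ> \<Psi>"
  have F_im: "F ` \<Phi> ` U = f ` U"
    by (simp add: F_def image_image inv)
  have F_eq: "F w = w - 2 * \<i> * of_real (Im (g (\<Psi> w)))" if "w \<in> \<Phi> ` U" for w
  proof -
    obtain z where z: "z \<in> U" "w = \<Phi> z"
      using \<open>w \<in> \<Phi> ` U\<close> by blast
    then have \<Psi>w: "\<Psi> w = z"
      by (simp add: inv)
    have "F w = h z + cnj (g z)"
      by (simp add: F_def f_def \<Psi>w)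
    also have "\<dots> = \<Phi> z - 2 * \<i> * of_real (Im (g z))"
      by (simp add: \<Phi>_def complex_eq_iff)
    finally show ?thesis
      by (simp only: \<Psi>w z(2)[symmetric])
  qed
  have contf: "continuous_on U f"
    unfolding f_def using h g by (intro continuous_intros holomorphic_on_imp_continuous_on)
  have contF: "continuous_on (\<Phi> ` U) F"
    unfolding F_def
  proof (rule continuous_on_compose)
    show "continuous_on (\<Phi> ` U) \<Psi>"
      by (rule holomorphic_on_imp_continuous_on[OF \<Psi>])
    show "continuous_on (\<Psi> ` \<Phi> ` U) f"
      using contf by (simp add: image_image inv)
  qed
  have speed: "\<exists>d>0. ((\<lambda>t::real. Im (F (w + \<i> * of_real t))) has_real_derivative d) (at 0)"
    if w: "w \<in> \<Phi> ` U" for w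
  proof -
    obtain z where z: "z \<in> U" "w = \<Phi> z"
      using w by blast
    have \<Phi>': "deriv \<Phi> z = deriv h z + deriv g z"
      unfolding \<Phi>_def using h g U(1) z(1) by (simp add: holomorphic_on_imp_differentiable_at)
    define D where "D = deriv g z / deriv \<Phi> z"
    have "deriv \<Phi> z \<noteq> 0"
      using \<Psi>'[OF z(1)] by auto
    then have D: "deriv h z / deriv \<Phi> z = 1 - D" and D_eq: "deriv g z * deriv \<Psi> w = D"
      using \<Psi>'[OF z(1)] \<Phi>' by (auto simp: D_def z(2) field_simps)
    have pos: "0 < 1 - 2 * Re D"
      using Re[OF z(1)] D \<Phi>' by simp
    have "(\<Psi> has_field_derivative deriv \<Psi> w) (at w)"
      using holomorphic_derivI[OF \<Psi> open_im w] .
    moreover have "(g has_field_derivative deriv g z) (at (\<Psi> w))"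
      using holomorphic_derivI[OF g U(1) z(1)] by (simp add: z inv)
    ultimately have gD: "((\<lambda>u. g (\<Psi> u)) has_field_derivative D) (at w)"
      unfolding D_eq[symmetric] by (rule DERIV_chain2[rotated])
    have "((\<lambda>t::real. w + \<i> * of_real t) has_vector_derivative \<i>) (at 0)"
      by (auto intro!: derivative_eq_intros simp: has_vector_derivative_def scaleR_conv_of_real)
    from field_vector_diff_chain_at[OF this, of "\<lambda>u. g (\<Psi> u)" D] gD
    have "((\<lambda>t::real. g (\<Psi> (w + \<i> * of_real t))) has_vector_derivative \<i> * D) (at 0)"
      by (simp add: o_def)
    then have ImD: "((\<lambda>t::real. Im (g (\<Psi> (w + \<i> * of_real t)))) has_real_derivative Re D) (at 0)"
      using bounded_linear.has_vector_derivative[OF bounded_linear_Im]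
      by (fastforce simp: has_real_derivative_iff_has_vector_derivative)
    have shear_deriv: "((\<lambda>t::real. Im w + t - 2 * Im (g (\<Psi> (w + \<i> * of_real t))))
        has_real_derivative (1 - 2 * Re D)) (at 0)"
      using DERIV_diff[OF DERIV_add[OF DERIV_const DERIV_ident] DERIV_cmult[OF ImD]] by simp
    have shear_eq: "eventually (\<lambda>t::real. Im w + t - 2 * Im (g (\<Psi> (w + \<i> * of_real t)))
        = Im (F (w + \<i> * of_real t))) (nhds 0)"
    proof -
      have "((\<lambda>t::real. w + \<i> * of_real t) \<longlongrightarrow> w + \<i> * of_real 0) (nhds 0)"
        by (intro tendsto_intros filterlim_ident)
      then have "eventually (\<lambda>t::real. w + \<i> * of_real t \<in> \<Phi> ` U) (nhds 0)"
        using open_im w by (intro topological_tendstoD) auto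
      then show ?thesis
        by eventually_elim (simp add: F_eq)
    qed
    have "((\<lambda>t::real. Im (F (w + \<i> * of_real t))) has_real_derivative (1 - 2 * Re D)) (at 0)"
      by (rule iffD1[OF DERIV_cong_ev[OF refl shear_eq refl] shear_deriv])
    with pos show ?thesis
      by blast
  qed
  have cid': "convex_imag_dir (\<Phi> ` U)"
    using cid by (simp add: \<Phi>_def)
  have injF: "inj_on F (\<Phi> ` U)" and cidF: "convex_imag_dir (F ` \<Phi> ` U)"
    using vertical_shear[OF cid' contF _ speed] F_eq by auto
  show "convex_imag_dir (f ` U)"
    using cidF by (simp only: F_im)
  show "inj_on f U"
  proof (rule inj_onI)
    fix x y assume xy: "x \<in> U" "y \<in> U" "f x = f y"
    then have "F (\<Phi> x) = F (\<Phi> y)"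
      by (simp add: F_def inv)
    then have "\<Phi> x = \<Phi> y"
      using injF xy by (blast dest: inj_onD)
    then show "x = y"
      using inv xy by metis
  qed
  then show "open (f ` U)"
    using invariance_of_domain[OF contf U(1)] by blast
  show "connected (f ` U)"
    by (rule connected_continuous_image[OF contf U(2)])
qed

text \<open>For \<open>w = a / (a + b)\<close> the claim says that \<open>w\<close> is closer to \<open>1\<close> than to \<open>0\<close>. The convention
  \<open>a / 0 = 0\<close> excludes \<open>a + b = 0\<close>.\<close>

lemma cmod_less_if_Re_gt_half:
  fixes a b :: complex
  assumes "Re (a / (a + b)) > 1 / 2"
  shows "cmod b < cmod a"
proof -
  define w where "w = a / (a + b)"
  have nz: "a + b \<noteq> 0"
    using assms by auto
  have "(cmod (1 - w))\<^sup>2 < (cmod w)\<^sup>2"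
    using assms unfolding cmod_power2 w_def[symmetric]
    by (simp add: power2_eq_square algebra_simps)
  then have "cmod (1 - w) < cmod w"
    by (rule power_less_imp_less_base) simp
  moreover have "a = w * (a + b)" "b = (1 - w) * (a + b)"
    using nz by (auto simp: w_def field_simps)
  ultimately show ?thesis
    using nz by (metis mult_strict_right_mono norm_mult zero_less_norm_iff)
qed

section \<open>Convolution of the two classes\<close>

theorem theorem3p1:
  fixes \<phi> f1 f2 h1 g1 h2 g2 :: "complex \<Rightarrow> complex"
  assumes "\<phi> \<in> class_A"
    and "f1 \<in> W_minus (\<lambda>z. z)" and "canonical_decomp f1 h1 g1"
    and "f2 \<in> W_plus \<phi>" and "canonical_decomp f2 h2 g2"
  shows "harmonic_conv f1 f2 \<in> W_plus (analytic_conv h1 \<phi>) \<and>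
    (inj_on (analytic_conv h1 \<phi>) unit_disc \<longrightarrow>
     fun_convex_imag_dir (analytic_conv h1 \<phi>) \<longrightarrow>
     (\<forall>z\<in>unit_disc. Re (deriv (analytic_conv h1 h2) z / deriv (analytic_conv h1 \<phi>) z) > 1 / 2) \<longrightarrow>
     harmonic_conv f1 f2 \<in> class_SH0 \<and> fun_convex_imag_dir (harmonic_conv f1 f2))"
proof -
  note d1 = assms(3) and d2 = assms(5)
  define H where "H = analytic_conv h1 h2"
  define G where "G = analytic_conv g1 g2"
  define \<Phi> where "\<Phi> = analytic_conv h1 \<phi>"
  define f where "f = harmonic_conv f1 f2"
  have diff: "h1 z - g1 z = z" if "z \<in> unit_disc" for z
    using assms(2) canonical_decomp_unique[OF d1 _ that] that by (force simp: W_minus_def)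
  have sum: "h2 z + g2 z = \<phi> z" if "z \<in> unit_disc" for z
    using assms(4) canonical_decomp_unique[OF d2 _ that] that by (force simp: W_plus_def)
  have d: "canonical_decomp f H G"
    unfolding f_def H_def G_def by (rule canonical_decomp_harmonic_conv[OF d1 d2])
  have HG: "H holomorphic_on unit_disc" "G holomorphic_on unit_disc"
    and f_eq: "\<And>z. z \<in> unit_disc \<Longrightarrow> f z = H z + cnj (G z)"
    using d by (auto simp: canonical_decomp_def)
  have \<Phi>_eq: "H z + G z = \<Phi> z" if "z \<in> unit_disc" for z
    unfolding H_def G_def \<Phi>_def
    by (rule analytic_conv_add_eq[OF _ _ _ _ diff sum _ that])
       (use d1 d2 in \<open>auto simp: canonical_decomp_def\<close>)
  have "f \<in> class_H"
    by (rule canonical_decomp_imp_class_H[OF d])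
  then have W: "f \<in> W_plus \<Phi>"
    using d \<Phi>_eq unfolding W_plus_def by blast
  have "f \<in> class_SH0 \<and> fun_convex_imag_dir f"
    if inj: "inj_on \<Phi> unit_disc" and cid: "fun_convex_imag_dir \<Phi>"
      and Re: "\<forall>z\<in>unit_disc. Re (deriv H z / deriv \<Phi> z) > 1 / 2"
  proof -
    have "deriv \<Phi> z = deriv H z + deriv G z" if z: "z \<in> unit_disc" for z
    proof -
      have "eventually (\<lambda>w. \<Phi> w = H w + G w) (nhds z)"
        by (rule eventually_mono[OF eventually_nhds_in_open[OF open_ball z]]) (simp add: \<Phi>_eq)
      then have "deriv \<Phi> z = deriv (\<lambda>w. H w + G w) z"
        by (rule deriv_cong_ev) simp
      then show ?thesis
        using HG z by (simp add: holomorphic_on_imp_differentiable_at[OF _ open_ball])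
    qed
    with Re have Re': "Re (deriv H z / (deriv H z + deriv G z)) > 1 / 2" if "z \<in> unit_disc" for z
      using that by metis
    have im: "(\<lambda>z. H z + G z) ` unit_disc = \<Phi> ` unit_disc"
      "(\<lambda>z. H z + cnj (G z)) ` unit_disc = f ` unit_disc"
      using \<Phi>_eq f_eq by (auto intro!: image_cong)
    have "inj_on (\<lambda>z. H z + G z) unit_disc"
      using inj \<Phi>_eq by (simp add: inj_on_def)
    moreover have "convex_imag_dir ((\<lambda>z. H z + G z) ` unit_disc)"
      using cid by (simp add: im fun_convex_imag_dir_def)
    ultimately have "inj_on (\<lambda>z. H z + cnj (G z)) unit_disc"
      and "open (f ` unit_disc)" "connected (f ` unit_disc)" "convex_imag_dir (f ` unit_disc)"
      using harmonic_shear[OF open_ball connected_ball HG _ _ Re'] by (auto simp: im)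
    then have "inj_on f unit_disc" and "fun_convex_imag_dir f"
      using f_eq by (auto simp: inj_on_def fun_convex_imag_dir_def)
    moreover have "sense_preserving f"
      using d cmod_less_if_Re_gt_half[OF Re'] unfolding sense_preserving_def by blast
    ultimately show ?thesis
      using \<open>f \<in> class_H\<close> by (simp add: class_SH0_def)
  qed
  then show ?thesis
    using W unfolding f_def H_def \<Phi>_def by blast
qed

end
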